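(* Let $M$ be a real Hilbert space and let $G$ be a group acting isometrically on $M$. Let $t_0\in M$, let $\Phi$ be a random element of $G$, let $\epsilon$ be a standardized noise in $M$ independent of $\Phi$, let $\sigma>0$, and let $Y=\Phi\cdot t_0+\sigma\epsilon$. Suppose that the support of $\epsilon$ is not included in the set of fixed points under the action of $G$. Put $$K=\sup_{v\in M,\ \|v\|=1}\ \mathbb{E}\Big(\sup_{g\in G}\langle v, g\cdot\epsilon\rangle\Big).$$ Then $K\in(0,1]$ ($K$ depends only on the standardized noise and on the group action). If the Fréchet mean of $[Y]$ exists, then the consistency bias $CB$ satisfies $$\sigma K-2\|t_0\|\ \le\ CB\ \le\ \sigma K+2\|t_0\|,$$ and the consistency bias has the following asymptotic behavior when the noise level $\sigma$ tends to infinity (with $t_0$, $\Phi$, $\epsilon$ and the action fixed): $$CB=\sigma K+o(\sigma)\quad\text{as }\sigma\to+\infty .$$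
   Context: $M$ is a Hilbert space with inner product $\langle\cdot,\cdot\rangle$ and norm $\|\cdot\|$. The group $G$ acts on $M$ ($g'\cdot(g\cdot x)=(g'g)\cdot x$, $e\cdot x=x$). The action is isometric if for each $g\in G$ the map $x\mapsto g\cdot x$ is linear and preserves the norm. A point $x\in M$ is a fixed point if $g\cdot x=x$ for all $g\in G$. The orbit of $x$ is $[x]=\{g\cdot x: g\in G\}$, and the quotient (pseudo-)distance is $d_Q([a],[b])=\inf_{g\in G}\|a-g\cdot b\|$. A standardized noise is an $M$-valued random variable $\epsilon$ with $\mathbb{E}(\epsilon)=0$ and $\mathbb{E}(\|\epsilon\|^2)=1$. Its support is the set of points all of whose neighbourhoods have positive probability under the law of $\epsilon$. The variance of $[Y]$ is $F(x)=\mathbb{E}\big(\inf_{g\in G}\|g\cdot x-Y\|^2\big)=\mathbb{E}\big(d_Q([x],[Y])^2\big)$ for $x\in M$. If $m_\star\in M$ minimizes $F$ over $M$, then $[m_\star]$ is called a Fréchet mean of $[Y]$, and the consistency bias is $CB=d_Q([t_0],[m_\star])$. *)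

theory Defs
  imports
    "HOL-Probability.Probability"
    "HOL-Algebra.Group_Action"
    "HOL-Library.Landau_Symbols"
begin

text \<open>
  The Hilbert space is the whole of a type of class \<open>{real_inner, complete_space}\<close>; it need not be
  separable. An action of \<open>G\<close> on it is a \<open>group_action G UNIV \<phi>\<close>, with \<open>\<phi> g x\<close> for \<open>g \<cdot> x\<close>.
\<close>

definition isometric_action ::
    "('g, 'r) monoid_scheme \<Rightarrow> ('g \<Rightarrow> 'm::real_normed_vector \<Rightarrow> 'm) \<Rightarrow> bool" where
  "isometric_action G \<phi> \<longleftrightarrow> group_action G UNIV \<phi> \<and>
     (\<forall>g\<in>carrier G. linear (\<phi> g) \<and> (\<forall>x. norm (\<phi> g x) = norm x))"

definition fixed_points :: "('g, 'r) monoid_scheme \<Rightarrow> ('g \<Rightarrow> 'm \<Rightarrow> 'm) \<Rightarrow> 'm set" where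
  "fixed_points G \<phi> = {x. \<forall>g\<in>carrier G. \<phi> g x = x}"

text \<open>The distance between the orbits of \<open>a\<close> and \<open>b\<close>, as a function of representatives.\<close>

definition quot_dist ::
    "('g, 'r) monoid_scheme \<Rightarrow> ('g \<Rightarrow> 'm::real_normed_vector \<Rightarrow> 'm) \<Rightarrow> 'm \<Rightarrow> 'm \<Rightarrow> real" where
  "quot_dist G \<phi> a b = (INF g\<in>carrier G. norm (a - \<phi> g b))"

text \<open>
  The library's Bochner integral is confined to second countable types, so the expectation of a
  vector in a general Hilbert space is the weak one. The two lemmas below show that it extends the
  Bochner expectation and agrees with it wherever the latter exists.
\<close>

definition has_expectation :: "'w measure \<Rightarrow> ('w \<Rightarrow> 'm::real_inner) \<Rightarrow> 'm \<Rightarrow> bool" where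
  "has_expectation P X m \<longleftrightarrow>
     (\<forall>v. integrable P (\<lambda>\<omega>. v \<bullet> X \<omega>) \<and> (\<integral>\<omega>. v \<bullet> X \<omega> \<partial>P) = v \<bullet> m)"

lemma has_bochner_integral_imp_has_expectation:
  fixes X :: "'w \<Rightarrow> 'm::{real_inner, complete_space, second_countable_topology}"
  assumes "has_bochner_integral P X m"
  shows "has_expectation P X m"
proof -
  have "has_bochner_integral P (\<lambda>\<omega>. v \<bullet> X \<omega>) (v \<bullet> m)" for v
    using assms by (rule has_bochner_integral_bounded_linear[OF bounded_linear_inner_right])
  then show ?thesis
    by (auto simp: has_expectation_def has_bochner_integral_iff)
qed

lemma has_expectation_iff_lebesgue_integral:
  fixes X :: "'w \<Rightarrow> 'm::{real_inner, complete_space, second_countable_topology}"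
  assumes "integrable P X"
  shows "has_expectation P X m \<longleftrightarrow> (\<integral>\<omega>. X \<omega> \<partial>P) = m"
proof -
  have "has_expectation P X (\<integral>\<omega>. X \<omega> \<partial>P)"
    using assms by (intro has_bochner_integral_imp_has_expectation has_bochner_integral_integrable)
  then show ?thesis
    unfolding has_expectation_def by (metis vector_eq_rdot inner_commute)
qed

definition standardized_noise :: "'w measure \<Rightarrow> ('w \<Rightarrow> 'm::real_inner) \<Rightarrow> bool" where
  "standardized_noise P \<epsilon> \<longleftrightarrow> \<epsilon> \<in> borel_measurable P \<and> has_expectation P \<epsilon> 0 \<and>
     integrable P (\<lambda>\<omega>. (norm (\<epsilon> \<omega>))\<^sup>2) \<and> (\<integral>\<omega>. (norm (\<epsilon> \<omega>))\<^sup>2 \<partial>P) = 1"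

definition law_support :: "'w measure \<Rightarrow> ('w \<Rightarrow> 'm::topological_space) \<Rightarrow> 'm set" where
  "law_support P X = {x. \<forall>U. open U \<longrightarrow> x \<in> U \<longrightarrow> measure (distr P borel X) U > 0}"

text \<open>
  Independence of random elements of possibly different types, which \<open>indep_var\<close> does not allow;
  on equal types this is how \<open>indep_var_eq\<close> characterizes it, up to passing from a
  \<open>\<sigma>\<close>-algebra to the intersection-stable generator that it equals.
\<close>

definition independent_rv ::
    "'w measure \<Rightarrow> 'a measure \<Rightarrow> ('w \<Rightarrow> 'a) \<Rightarrow> 'b measure \<Rightarrow> ('w \<Rightarrow> 'b) \<Rightarrow> bool" where
  "independent_rv P A X B Y \<longleftrightarrow> X \<in> measurable P A \<and> Y \<in> measurable P B \<and>
     prob_space.indep_set P {X -` S \<inter> space P |S. S \<in> sets A} {Y -` S \<inter> space P |S. S \<in> sets B}"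

text \<open>The random variable \<open>Y = \<Phi> \<cdot> t\<^sub>0 + \<sigma> \<epsilon>\<close>.\<close>

definition observation ::
    "('g \<Rightarrow> 'm::real_vector \<Rightarrow> 'm) \<Rightarrow> 'm \<Rightarrow> ('w \<Rightarrow> 'g) \<Rightarrow> ('w \<Rightarrow> 'm) \<Rightarrow> real \<Rightarrow> 'w \<Rightarrow> 'm" where
  "observation \<phi> t\<^sub>0 \<Phi> \<epsilon> \<sigma> \<omega> = \<phi> (\<Phi> \<omega>) t\<^sub>0 + \<sigma> *\<^sub>R \<epsilon> \<omega>"

definition orbit_variance ::
    "'w measure \<Rightarrow> ('g, 'r) monoid_scheme \<Rightarrow> ('g \<Rightarrow> 'm::real_normed_vector \<Rightarrow> 'm) \<Rightarrow>
     ('w \<Rightarrow> 'm) \<Rightarrow> 'm \<Rightarrow> real" where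
  "orbit_variance P G \<phi> Y x = (\<integral>\<omega>. (INF g\<in>carrier G. (norm (\<phi> g x - Y \<omega>))\<^sup>2) \<partial>P)"

text \<open>\<open>m\<close> represents a Frechet mean of \<open>[Y]\<close>, i.e. the orbit of \<open>m\<close> is one.\<close>

definition represents_frechet_mean ::
    "'w measure \<Rightarrow> ('g, 'r) monoid_scheme \<Rightarrow> ('g \<Rightarrow> 'm::real_normed_vector \<Rightarrow> 'm) \<Rightarrow>
     ('w \<Rightarrow> 'm) \<Rightarrow> 'm \<Rightarrow> bool" where
  "represents_frechet_mean P G \<phi> Y m \<longleftrightarrow>
     (\<forall>x. orbit_variance P G \<phi> Y m \<le> orbit_variance P G \<phi> Y x)"

definition bias_constant ::
    "'w measure \<Rightarrow> ('g, 'r) monoid_scheme \<Rightarrow> ('g \<Rightarrow> 'm::real_inner \<Rightarrow> 'm) \<Rightarrow> ('w \<Rightarrow> 'm) \<Rightarrow> real" where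
  "bias_constant P G \<phi> \<epsilon> =
     (SUP v\<in>{v. norm v = 1}. \<integral>\<omega>. (SUP g\<in>carrier G. v \<bullet> \<phi> g (\<epsilon> \<omega>)) \<partial>P)"

end

theory Submission
  imports Defs
begin

text \<open>
  Because the action is isometric, \<open>\<parallel>g \<cdot> x - y\<parallel>\<^sup>2 = \<parallel>x\<parallel>\<^sup>2 + \<parallel>y\<parallel>\<^sup>2 - 2 \<langle>x, g\<^sup>-\<^sup>1 \<cdot> y\<rangle>\<close>, so that minimizing over
  \<open>g\<close> turns the variance into
  \<open>F x = \<parallel>x\<parallel>\<^sup>2 - 2 \<Lambda> x + E \<parallel>Y\<parallel>\<^sup>2\<close> with \<open>\<Lambda> x = E (sup\<^sub>g \<langle>x, g \<cdot> Y\<rangle>)\<close>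
  (\<open>orbit_variance_eq\<close>). The function \<open>\<Lambda>\<close> is positively homogeneous, so along each ray \<open>F\<close> is a
  quadratic polynomial in the radius, and a minimizer \<open>m\<close> satisfies \<open>\<Lambda> m = \<parallel>m\<parallel>\<^sup>2\<close> and
  \<open>\<Lambda> w \<le> \<parallel>m\<parallel>\<close> for all unit vectors \<open>w\<close> (\<open>minimizer_radial\<close>): the norm of \<open>m\<close> is the maximum of \<open>\<Lambda>\<close>
  over the unit sphere, cut off at \<open>0\<close>.

  The function \<open>y \<mapsto> sup\<^sub>g \<langle>w, g \<cdot> y\<rangle>\<close> is the support function, in direction \<open>w\<close>, of the orbit of \<open>y\<close>.
  It is 1-Lipschitz in \<open>y\<close> for a unit vector \<open>w\<close>, and \<open>Y\<close> is within \<open>\<parallel>t\<^sub>0\<parallel>\<close> of \<open>\<sigma> \<epsilon>\<close>. Hence \<open>\<Lambda> w\<close>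
  is within \<open>\<parallel>t\<^sub>0\<parallel>\<close> of \<open>\<sigma> E (sup\<^sub>g \<langle>w, g \<cdot> \<epsilon>\<rangle>)\<close>; passing to the supremum over \<open>w\<close>, the norm of \<open>m\<close> is
  within \<open>\<parallel>t\<^sub>0\<parallel>\<close> of \<open>\<sigma> K\<close> (\<open>norm_frechet_mean\<close>). The quotient distance from \<open>t\<^sub>0\<close> to \<open>m\<close> differs from
  \<open>\<parallel>m\<parallel>\<close> by at most another \<open>\<parallel>t\<^sub>0\<parallel>\<close>, which gives both bounds on the bias, and the asymptotic
  behaviour follows as their gap does not depend on \<open>\<sigma>\<close>.

  The bound \<open>K \<le> 1\<close> is the Cauchy-Schwarz inequality. For \<open>K > 0\<close>, pick a point \<open>x\<close> of the support
  of \<open>\<epsilon>\<close> moved by some \<open>g\<close>, and let \<open>v\<close> point in the direction of \<open>g \<cdot> x\<close>. Then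
  \<open>sup\<^sub>h \<langle>v, h \<cdot> \<epsilon>\<rangle>\<close> is always at least \<open>\<langle>v, \<epsilon>\<rangle>\<close>, which has mean \<open>0\<close>, and exceeds it
  when \<open>\<epsilon>\<close> is near \<open>x\<close>, an event of positive probability.
\<close>

section \<open>Support functions of orbits\<close>

definition orbit_support ::
    "('g, 'r) monoid_scheme \<Rightarrow> ('g \<Rightarrow> 'm::real_inner \<Rightarrow> 'm) \<Rightarrow> 'm \<Rightarrow> 'm \<Rightarrow> real" where
  "orbit_support G \<phi> v y = (SUP g\<in>carrier G. v \<bullet> \<phi> g y)"

locale isometric_group_action =
  fixes G :: "('g, 'r) monoid_scheme"
    and \<phi> :: "'g \<Rightarrow> 'm::real_inner \<Rightarrow> 'm"
  assumes isometric: "isometric_action G \<phi>"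
begin

sublocale group_action G UNIV \<phi>
  using isometric by (simp add: isometric_action_def)

lemma one_carrier: "\<one>\<^bsub>G\<^esub> \<in> carrier G"
  using group_hom by (simp add: group_hom_def group.is_monoid monoid.one_closed)

lemma carrier_nonempty: "carrier G \<noteq> {}"
  using one_carrier by blast

lemma act_one: "\<phi> \<one>\<^bsub>G\<^esub> x = x"
  using fun_cong[OF id_eq_one, of x] by simp

lemma linear_act: "g \<in> carrier G \<Longrightarrow> linear (\<phi> g)"
  using isometric by (simp add: isometric_action_def)

lemma norm_act [simp]: "g \<in> carrier G \<Longrightarrow> norm (\<phi> g x) = norm x"
  using isometric by (simp add: isometric_action_def)

lemma inner_act_act: "g \<in> carrier G \<Longrightarrow> \<phi> g x \<bullet> \<phi> g y = x \<bullet> y"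
  by (simp add: dot_norm linear_act flip: linear_add)

lemma inner_act_inv: "g \<in> carrier G \<Longrightarrow> \<phi> (inv\<^bsub>G\<^esub> g) x \<bullet> y = x \<bullet> \<phi> g y"
proof -
  assume g: "g \<in> carrier G"
  then have "inv\<^bsub>G\<^esub> g \<in> carrier G"
    using group_hom by (simp add: group_hom_def group.inv_closed)
  moreover have "\<phi> (inv\<^bsub>G\<^esub> g) (\<phi> g y) = y"
    using orbit_sym_aux[OF g, of y "\<phi> g y"] by simp
  ultimately show ?thesis
    using inner_act_act[of "inv\<^bsub>G\<^esub> g" x "\<phi> g y"] by simp
qed

lemma act_image_inv: "(\<lambda>g. \<phi> g x \<bullet> y) ` carrier G = (\<lambda>g. x \<bullet> \<phi> g y) ` carrier G"
proof -
  have G: "group G"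
    using group_hom by (simp add: group_hom_def)
  show ?thesis
  proof (intro equalityI image_subsetI)
    fix g assume g: "g \<in> carrier G"
    have "\<phi> g x \<bullet> y = x \<bullet> \<phi> (inv\<^bsub>G\<^esub> g) y"
      using inner_act_inv[of "inv\<^bsub>G\<^esub> g" x y] g G by simp
    then show "\<phi> g x \<bullet> y \<in> (\<lambda>g. x \<bullet> \<phi> g y) ` carrier G"
      using g G by simp
    show "x \<bullet> \<phi> g y \<in> (\<lambda>g. \<phi> g x \<bullet> y) ` carrier G"
      using inner_act_inv[OF g, of x y, symmetric] g G by simp
  qed
qed

lemma inner_act_le: "g \<in> carrier G \<Longrightarrow> v \<bullet> \<phi> g y \<le> norm v * norm y"
  using norm_cauchy_schwarz[of v "\<phi> g y"] by simp

lemma bdd_above_inner_act: "bdd_above ((\<lambda>g. v \<bullet> \<phi> g y) ` carrier G)"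
  using inner_act_le by (intro bdd_aboveI2)

lemma inner_act_le_orbit_support: "g \<in> carrier G \<Longrightarrow> v \<bullet> \<phi> g y \<le> orbit_support G \<phi> v y"
  unfolding orbit_support_def by (intro cSUP_upper bdd_above_inner_act)

lemma inner_le_orbit_support: "v \<bullet> y \<le> orbit_support G \<phi> v y"
  using inner_act_le_orbit_support[OF one_carrier] by (simp add: act_one)

lemma orbit_support_le:
  "(\<And>g. g \<in> carrier G \<Longrightarrow> v \<bullet> \<phi> g y \<le> b) \<Longrightarrow> orbit_support G \<phi> v y \<le> b"
  unfolding orbit_support_def by (intro cSUP_least carrier_nonempty)

lemma orbit_support_le_norm: "orbit_support G \<phi> v y \<le> norm v * norm y"
  by (intro orbit_support_le inner_act_le)

lemma abs_orbit_support_le: "\<bar>orbit_support G \<phi> v y\<bar> \<le> norm v * norm y"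
  using orbit_support_le_norm[of v y] inner_le_orbit_support[of v y]
    Cauchy_Schwarz_ineq2[of v y] by linarith

text \<open>
  A supremum of functions with a common Lipschitz constant has the same constant. This serves twice:
  continuity makes the support functions of random vectors measurable, even when the group is
  uncountable or the space is not separable, and the constant measures the effect of replacing
  \<open>Y\<close> by \<open>\<sigma> \<epsilon>\<close>.
\<close>

lemma orbit_support_Lipschitz:
  "\<bar>orbit_support G \<phi> v y - orbit_support G \<phi> v z\<bar> \<le> norm v * norm (y - z)"
proof -
  have "orbit_support G \<phi> v y \<le> orbit_support G \<phi> v z + norm v * norm (y - z)" for y z
  proof (rule orbit_support_le)
    fix g assume g: "g \<in> carrier G"
    have "v \<bullet> \<phi> g y = v \<bullet> \<phi> g z + v \<bullet> \<phi> g (y - z)"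
      using linear_act[OF g] by (simp add: linear_diff inner_diff_right)
    then show "v \<bullet> \<phi> g y \<le> orbit_support G \<phi> v z + norm v * norm (y - z)"
      using inner_act_le[OF g, of v "y - z"] inner_act_le_orbit_support[OF g, of v z] by linarith
  qed
  from this[of y z] this[of z y] show ?thesis
    by (simp add: norm_minus_commute)
qed

lemma continuous_orbit_support: "continuous_on S (orbit_support G \<phi> v)"
proof (rule continuous_on_subset)
  show "continuous_on UNIV (orbit_support G \<phi> v)"
  proof (rule lipschitz_on_continuous_on)
    show "(norm v)-lipschitz_on UNIV (orbit_support G \<phi> v)"
      by (rule lipschitz_onI) (auto simp: dist_norm orbit_support_Lipschitz)
  qed
qed simp

lemma orbit_support_scaleR_left:
  assumes "0 \<le> r"
  shows "orbit_support G \<phi> (r *\<^sub>R v) y = r * orbit_support G \<phi> v y"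
proof (cases "r = 0")
  case True
  then show ?thesis
    using carrier_nonempty by (simp add: orbit_support_def)
next
  case False
  with assms have r: "r > 0" by simp
  show ?thesis
  proof (rule antisym)
    show "orbit_support G \<phi> (r *\<^sub>R v) y \<le> r * orbit_support G \<phi> v y"
      using r inner_act_le_orbit_support by (intro orbit_support_le) simp
    have "orbit_support G \<phi> v y \<le> orbit_support G \<phi> (r *\<^sub>R v) y / r"
    proof (rule orbit_support_le)
      fix g assume "g \<in> carrier G"
      from inner_act_le_orbit_support[OF this, of "r *\<^sub>R v" y]
      show "v \<bullet> \<phi> g y \<le> orbit_support G \<phi> (r *\<^sub>R v) y / r"
        using r by (simp add: field_simps)
    qed
    then show "r * orbit_support G \<phi> v y \<le> orbit_support G \<phi> (r *\<^sub>R v) y"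
      using r by (simp add: field_simps)
  qed
qed

lemma orbit_support_scaleR_right:
  assumes "0 \<le> r"
  shows "orbit_support G \<phi> v (r *\<^sub>R y) = r * orbit_support G \<phi> v y"
proof -
  have "orbit_support G \<phi> v (r *\<^sub>R y) = orbit_support G \<phi> (r *\<^sub>R v) y"
    unfolding orbit_support_def
    by (intro SUP_cong) (simp_all add: linear_scale linear_act)
  then show ?thesis
    using assms by (simp add: orbit_support_scaleR_left)
qed

text \<open>
  Since \<open>\<parallel>g \<cdot> x\<parallel> = \<parallel>x\<parallel>\<close>, only the cross term of the expanded square varies with \<open>g\<close>. It is
  \<open>\<langle>g \<cdot> x, y\<rangle> = \<langle>x, g\<^sup>-\<^sup>1 \<cdot> y\<rangle>\<close>, and \<open>g\<^sup>-\<^sup>1\<close> runs through the whole group.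
\<close>

lemma INF_norm_act_diff_power2:
  "(INF g\<in>carrier G. (norm (\<phi> g x - y))\<^sup>2) = (norm x)\<^sup>2 + (norm y)\<^sup>2 - 2 * orbit_support G \<phi> x y"
    (is "?I = ?r")
proof -
  have expand: "(norm (\<phi> g x - y))\<^sup>2 = (norm x)\<^sup>2 + (norm y)\<^sup>2 - 2 * (\<phi> g x \<bullet> y)"
    if "g \<in> carrier G" for g
    using dot_norm_neg[of "\<phi> g x" y] that by simp
  have sup: "orbit_support G \<phi> x y = (SUP g\<in>carrier G. \<phi> g x \<bullet> y)"
    by (simp add: orbit_support_def act_image_inv)
  have bdd: "bdd_above ((\<lambda>g. \<phi> g x \<bullet> y) ` carrier G)"
    by (simp add: act_image_inv bdd_above_inner_act)
  show ?thesis
  proof (rule antisym)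
    have "\<phi> g x \<bullet> y \<le> ((norm x)\<^sup>2 + (norm y)\<^sup>2 - ?I) / 2" if g: "g \<in> carrier G" for g
    proof -
      have "?I \<le> (norm (\<phi> g x - y))\<^sup>2"
        by (intro cINF_lower g bdd_belowI2[where m = 0]) simp
      then show ?thesis
        using expand[OF g] by simp
    qed
    then have "orbit_support G \<phi> x y \<le> ((norm x)\<^sup>2 + (norm y)\<^sup>2 - ?I) / 2"
      unfolding sup by (intro cSUP_least carrier_nonempty)
    then show "?I \<le> ?r" by simp
    show "?r \<le> ?I"
    proof (rule cINF_greatest[OF carrier_nonempty])
      fix g assume g: "g \<in> carrier G"
      have "\<phi> g x \<bullet> y \<le> orbit_support G \<phi> x y"
        unfolding sup by (intro cSUP_upper g bdd)
      then show "?r \<le> (norm (\<phi> g x - y))\<^sup>2"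
        using expand[OF g] by simp
    qed
  qed
qed

text \<open>
  All points of the orbit of \<open>b\<close> have the norm of \<open>b\<close>, so their distances from \<open>a\<close> lie between
  \<open>\<parallel>b\<parallel> - \<parallel>a\<parallel>\<close> and \<open>\<parallel>b\<parallel> + \<parallel>a\<parallel>\<close>.
\<close>

lemma quot_dist_norm_bound: "\<bar>quot_dist G \<phi> a b - norm b\<bar> \<le> norm a"
proof -
  have "norm b - norm a \<le> quot_dist G \<phi> a b"
    unfolding quot_dist_def
  proof (rule cINF_greatest[OF carrier_nonempty])
    fix g assume "g \<in> carrier G"
    then show "norm b - norm a \<le> norm (a - \<phi> g b)"
      using norm_triangle_ineq2[of "\<phi> g b" a] by (simp add: norm_minus_commute)
  qed
  moreover have "quot_dist G \<phi> a b \<le> norm (a - \<phi> \<one>\<^bsub>G\<^esub> b)"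
    unfolding quot_dist_def by (intro cINF_lower one_carrier bdd_belowI2[where m = 0]) simp
  moreover have "norm (a - \<phi> \<one>\<^bsub>G\<^esub> b) \<le> norm a + norm b"
    using norm_triangle_ineq4 by (simp add: act_one)
  ultimately show ?thesis by linarith
qed

end

section \<open>Minimizers of radially quadratic functions\<close>

text \<open>
  On the ray through \<open>m\<close> the function is the quadratic polynomial \<open>t\<^sup>2 \<parallel>m\<parallel>\<^sup>2 - 2 t L m + C\<close>. Its minimum
  over \<open>t \<ge> 0\<close> is at \<open>t = 1\<close>, which forces \<open>L m = \<parallel>m\<parallel>\<^sup>2\<close>, so the minimum is
  \<open>C - \<parallel>m\<parallel>\<^sup>2\<close>. On the ray through a unit vector \<open>w\<close> with \<open>L w > 0\<close>, the value \<open>C - (L w)\<^sup>2\<close>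
  is reached at radius \<open>L w\<close>.
\<close>

lemma minimizer_radial:
  fixes L :: "'m::real_normed_vector \<Rightarrow> real"
  assumes homogeneous: "\<And>r x. 0 \<le> r \<Longrightarrow> L (r *\<^sub>R x) = r * L x"
    and minimizer: "\<And>x. (norm m)\<^sup>2 - 2 * L m + C \<le> (norm x)\<^sup>2 - 2 * L x + C"
  shows "L m = (norm m)\<^sup>2" and "norm w = 1 \<Longrightarrow> L w \<le> norm m"
proof -
  have "0 \<le> (t - 1) * ((t + 1) * (norm m)\<^sup>2 - 2 * L m)" if "0 \<le> t" for t
    using minimizer[of "t *\<^sub>R m"] that
    by (simp add: homogeneous power_mult_distrib algebra_simps power2_eq_square)
  note ray = this
  show stationary: "L m = (norm m)\<^sup>2"
  proof (rule ccontr)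
    assume ne: "L m \<noteq> (norm m)\<^sup>2"
    show False
    proof (cases "m = 0")
      case True
      then show False
        using homogeneous[of 0 m] ne by simp
    next
      case False
      define a where "a = (norm m)\<^sup>2"
      have a: "a > 0"
        using False by (simp add: a_def)
      \<comment> \<open>The vertex \<open>t = L m / a\<close> of the quadratic polynomial, or the apex \<open>t = 0\<close> of the ray if the
        vertex lies outside of the ray.\<close>
      show False
      proof (cases "0 \<le> L m")
        case True
        define t where "t = L m / a"
        have "0 \<le> t" and L: "L m = t * a"
          using True a by (simp_all add: t_def)
        have "0 \<le> (t - 1) * ((t + 1) * a - 2 * (t * a))"
          using ray[OF \<open>0 \<le> t\<close>] unfolding a_def[symmetric] L .
        also have "\<dots> = - (a * (t - 1)\<^sup>2)"
          by (simp add: power2_eq_square algebra_simps)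
        finally have "a * (t - 1)\<^sup>2 \<le> 0" by simp
        with a have "t = 1"
          by (simp add: mult_le_0_iff)
        then show False
          using L ne by (simp add: a_def)
      next
        case False
        then show False
          using ray[of 0] zero_le_power2[of "norm m"] by simp
      qed
    qed
  qed
  show "L w \<le> norm m" if w: "norm w = 1"
  proof (cases "L w > 0")
    case True
    have "(norm m)\<^sup>2 \<ge> (L w)\<^sup>2"
      using minimizer[of "L w *\<^sub>R w"] True w
      by (simp add: homogeneous stationary power2_eq_square)
    then show ?thesis
      by (rule power2_le_imp_le) simp
  next
    case False
    then show ?thesis
      using norm_ge_zero[of m] by linarith
  qed
qed

section \<open>Expected support functions\<close>

locale noisy_isometric_group_action = isometric_group_action G \<phi> + prob_space P
  for G :: "('g, 'r) monoid_scheme"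
    and \<phi> :: "'g \<Rightarrow> 'm::real_inner \<Rightarrow> 'm"
    and P :: "'w measure" +
  fixes \<epsilon> :: "'w \<Rightarrow> 'm"
  assumes noise: "standardized_noise P \<epsilon>"
begin

lemma borel_measurable_orbit_support [measurable]:
  "X \<in> borel_measurable P \<Longrightarrow> (\<lambda>\<omega>. orbit_support G \<phi> v (X \<omega>)) \<in> borel_measurable P"
  by (rule borel_measurable_continuous_on[OF continuous_orbit_support])

lemma integrable_norm_of_square:
  assumes [measurable]: "X \<in> borel_measurable P"
    and "integrable P (\<lambda>\<omega>. (norm (X \<omega> :: 'm))\<^sup>2)"
  shows "integrable P (\<lambda>\<omega>. norm (X \<omega>))"
  using assms(2) by (rule square_integrable_imp_integrable[rotated]) measurable

lemma integrable_orbit_support: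
  assumes [measurable]: "X \<in> borel_measurable P" and "integrable P (\<lambda>\<omega>. (norm (X \<omega>))\<^sup>2)"
  shows "integrable P (\<lambda>\<omega>. orbit_support G \<phi> v (X \<omega>))"
proof (rule Bochner_Integration.integrable_bound)
  show "integrable P (\<lambda>\<omega>. norm v * norm (X \<omega>))"
    using integrable_norm_of_square[OF assms] by simp
  show "(\<lambda>\<omega>. orbit_support G \<phi> v (X \<omega>)) \<in> borel_measurable P"
    by measurable
  show "AE \<omega> in P. norm (orbit_support G \<phi> v (X \<omega>)) \<le> norm (norm v * norm (X \<omega>))"
    by (simp add: abs_orbit_support_le)
qed

lemma orbit_variance_eq:
  assumes [measurable]: "X \<in> borel_measurable P" and "integrable P (\<lambda>\<omega>. (norm (X \<omega>))\<^sup>2)"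
  shows "orbit_variance P G \<phi> X x =
    (norm x)\<^sup>2 - 2 * (\<integral>\<omega>. orbit_support G \<phi> x (X \<omega>) \<partial>P) + (\<integral>\<omega>. (norm (X \<omega>))\<^sup>2 \<partial>P)"
  using assms(2) integrable_orbit_support[OF assms]
  by (simp add: orbit_variance_def INF_norm_act_diff_power2 prob_space)

lemma noise_measurable [measurable]: "\<epsilon> \<in> borel_measurable P"
  using noise by (simp add: standardized_noise_def)

lemma noise_square_integrable: "integrable P (\<lambda>\<omega>. (norm (\<epsilon> \<omega>))\<^sup>2)"
  using noise by (simp add: standardized_noise_def)

lemma integrable_norm_noise: "integrable P (\<lambda>\<omega>. norm (\<epsilon> \<omega>))"
  by (rule integrable_norm_of_square[OF noise_measurable noise_square_integrable])

lemma integrable_noise_support: "integrable P (\<lambda>\<omega>. orbit_support G \<phi> v (\<epsilon> \<omega>))"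
  by (rule integrable_orbit_support[OF noise_measurable noise_square_integrable])

lemma expectation_norm_noise_le_1: "(\<integral>\<omega>. norm (\<epsilon> \<omega>) \<partial>P) \<le> 1"
proof -
  have "(\<integral>\<omega>. norm (\<epsilon> \<omega>) \<partial>P)\<^sup>2 \<le> (\<integral>\<omega>. (norm (\<epsilon> \<omega>))\<^sup>2 \<partial>P)"
    using variance_positive[of "\<lambda>\<omega>. norm (\<epsilon> \<omega>)"]
      variance_eq[OF integrable_norm_noise noise_square_integrable] by simp
  then have "(\<integral>\<omega>. norm (\<epsilon> \<omega>) \<partial>P)\<^sup>2 \<le> 1\<^sup>2"
    using noise by (simp add: standardized_noise_def)
  then show ?thesis
    by (rule power2_le_imp_le) simp
qed

section \<open>The bias constant\<close>

lemma bias_constant_eq: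
  "bias_constant P G \<phi> \<epsilon> = (SUP v\<in>{v. norm v = 1}. \<integral>\<omega>. orbit_support G \<phi> v (\<epsilon> \<omega>) \<partial>P)"
  by (simp add: bias_constant_def orbit_support_def)

lemma expectation_noise_support_le_1:
  assumes "norm v = 1"
  shows "(\<integral>\<omega>. orbit_support G \<phi> v (\<epsilon> \<omega>) \<partial>P) \<le> 1"
proof -
  have "(\<integral>\<omega>. orbit_support G \<phi> v (\<epsilon> \<omega>) \<partial>P) \<le> (\<integral>\<omega>. norm (\<epsilon> \<omega>) \<partial>P)"
    using orbit_support_le_norm[of v] assms
    by (intro integral_mono integrable_noise_support integrable_norm_noise) simp
  then show ?thesis
    using expectation_norm_noise_le_1 by linarith
qed

lemma expectation_noise_support_le_bias_constant:
  "norm v = 1 \<Longrightarrow> (\<integral>\<omega>. orbit_support G \<phi> v (\<epsilon> \<omega>) \<partial>P) \<le> bias_constant P G \<phi> \<epsilon>"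
  unfolding bias_constant_eq
  by (intro cSUP_upper bdd_aboveI2[where M = 1] expectation_noise_support_le_1) auto

text \<open>
  The vectors \<open>x\<close> and \<open>g \<cdot> x\<close> are distinct of equal norm, so \<open>\<langle>g \<cdot> x, x\<rangle> < \<langle>g \<cdot> x, g \<cdot> x\<rangle>\<close>. By continuity the
  support function in direction \<open>g \<cdot> x\<close> exceeds the inner product on a neighbourhood of \<open>x\<close>.
\<close>

lemma expectation_noise_support_pos:
  assumes x: "x \<in> law_support P \<epsilon>" and g: "g \<in> carrier G" and moved: "\<phi> g x \<noteq> x"
  shows "0 < (\<integral>\<omega>. orbit_support G \<phi> (\<phi> g x) (\<epsilon> \<omega>) \<partial>P)"
proof -
  define v where "v = \<phi> g x"
  define f where "f y = orbit_support G \<phi> v y - v \<bullet> y" for y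
  have f_nonneg: "0 \<le> f y" for y
    using inner_le_orbit_support[of v y] by (simp add: f_def)
  have mean: "integrable P (\<lambda>\<omega>. v \<bullet> \<epsilon> \<omega>)" "(\<integral>\<omega>. v \<bullet> \<epsilon> \<omega> \<partial>P) = 0"
    using noise by (simp_all add: standardized_noise_def has_expectation_def)
  have int_f: "integrable P (\<lambda>\<omega>. f (\<epsilon> \<omega>))"
    unfolding f_def by (intro Bochner_Integration.integrable_diff integrable_noise_support mean)
  have E_f: "(\<integral>\<omega>. f (\<epsilon> \<omega>) \<partial>P) = (\<integral>\<omega>. orbit_support G \<phi> v (\<epsilon> \<omega>) \<partial>P)"
    unfolding f_def using integrable_noise_support mean by simp
  have "v \<bullet> v = x \<bullet> x"
    using g by (simp add: v_def inner_act_act)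
  have "0 < (v - x) \<bullet> (v - x)"
    using moved by (simp add: v_def)
  also have "\<dots> = 2 * (v \<bullet> v - v \<bullet> x)"
    using \<open>v \<bullet> v = x \<bullet> x\<close> by (simp add: inner_diff_left inner_diff_right inner_commute)
  finally have "v \<bullet> x < v \<bullet> v"
    by simp
  then have f_x: "0 < f x"
    using inner_act_le_orbit_support[OF g, of v x] by (simp add: f_def v_def)
  have "continuous_on UNIV f"
    unfolding f_def by (intro continuous_intros continuous_orbit_support)
  then have op: "open {y. 0 < f y}"
    by (intro open_Collect_less continuous_intros)
  have "0 < measure (distr P borel \<epsilon>) {y. 0 < f y}"
    using x f_x op by (simp add: law_support_def)
  also have "measure (distr P borel \<epsilon>) {y. 0 < f y} = prob {\<omega> \<in> space P. 0 < f (\<epsilon> \<omega>)}"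
    using op by (subst measure_distr) (auto intro!: arg_cong[where f = prob])
  finally have pos: "0 < prob {\<omega> \<in> space P. 0 < f (\<epsilon> \<omega>)}" .
  have "(\<integral>\<omega>. f (\<epsilon> \<omega>) \<partial>P) \<noteq> 0"
  proof
    assume "(\<integral>\<omega>. f (\<epsilon> \<omega>) \<partial>P) = 0"
    then have "AE \<omega> in P. \<not> 0 < f (\<epsilon> \<omega>)"
      using integral_nonneg_eq_0_iff_AE[OF int_f] f_nonneg by auto
    then have "prob {\<omega> \<in> space P. 0 < f (\<epsilon> \<omega>)} = 0"
      using int_f by (subst prob_eq_0) (auto intro!: borel_measurable_less)
    then show False
      using pos by simp
  qed
  moreover have "0 \<le> (\<integral>\<omega>. f (\<epsilon> \<omega>) \<partial>P)"
    using f_nonneg by simp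
  ultimately show ?thesis
    using E_f by (simp add: v_def)
qed

lemma bias_constant_bounds:
  assumes "\<not> law_support P \<epsilon> \<subseteq> fixed_points G \<phi>"
  shows "0 < bias_constant P G \<phi> \<epsilon>" "bias_constant P G \<phi> \<epsilon> \<le> 1"
proof -
  obtain x g where x: "x \<in> law_support P \<epsilon>" and g: "g \<in> carrier G" and moved: "\<phi> g x \<noteq> x"
    using assms by (auto simp: fixed_points_def)
  have nz: "x \<noteq> 0"
    using moved linear_0[OF linear_act[OF g]] by auto
  define u where "u = (1 / norm x) *\<^sub>R \<phi> g x"
  have u: "norm u = 1"
    using nz g by (simp add: u_def)
  have "0 < (\<integral>\<omega>. orbit_support G \<phi> (\<phi> g x) (\<epsilon> \<omega>) \<partial>P) / norm x"
    using expectation_noise_support_pos[OF x g moved] nz by simp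
  also have "\<dots> = (\<integral>\<omega>. orbit_support G \<phi> u (\<epsilon> \<omega>) \<partial>P)"
    by (simp add: u_def orbit_support_scaleR_left)
  also have "\<dots> \<le> bias_constant P G \<phi> \<epsilon>"
    by (rule expectation_noise_support_le_bias_constant[OF u])
  finally show "0 < bias_constant P G \<phi> \<epsilon>" .
  show "bias_constant P G \<phi> \<epsilon> \<le> 1"
    unfolding bias_constant_eq
    using u expectation_noise_support_le_1 by (intro cSUP_least) auto
qed

section \<open>The norm of a Frechet mean\<close>

text \<open>
  The bound \<open>\<delta>\<close> on the distance between \<open>Y\<close> and \<open>\<sigma> \<epsilon>\<close> passes, uniformly on the unit sphere, to the
  expected support functions of \<open>Y\<close> and of \<open>\<sigma> \<epsilon>\<close>. The norm of a minimizer is the supremum of the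
  former, cut off at \<open>0\<close>, and \<open>\<sigma> K\<close> is the supremum of the latter.
\<close>

lemma norm_frechet_mean:
  assumes Y [measurable]: "Y \<in> borel_measurable P"
    and close: "\<And>\<omega>. \<omega> \<in> space P \<Longrightarrow> norm (Y \<omega> - \<sigma> *\<^sub>R \<epsilon> \<omega>) \<le> \<delta>"
    and "0 \<le> \<sigma>"
    and K_nonneg: "0 \<le> bias_constant P G \<phi> \<epsilon>"
    and unit: "\<exists>v :: 'm. norm v = 1"
    and mean: "represents_frechet_mean P G \<phi> Y m"
  shows "\<bar>norm m - \<sigma> * bias_constant P G \<phi> \<epsilon>\<bar> \<le> \<delta>"
proof -
  define K where "K = bias_constant P G \<phi> \<epsilon>"
  define L where "L x = (\<integral>\<omega>. orbit_support G \<phi> x (Y \<omega>) \<partial>P)" for x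
  define L\<epsilon> where "L\<epsilon> x = (\<integral>\<omega>. orbit_support G \<phi> x (\<epsilon> \<omega>) \<partial>P)" for x
  obtain \<omega>\<^sub>0 where "\<omega>\<^sub>0 \<in> space P"
    using not_empty by blast
  with close[of \<omega>\<^sub>0] have \<delta>: "0 \<le> \<delta>"
    by (meson norm_ge_zero order_trans)
  have Y_square: "integrable P (\<lambda>\<omega>. (norm (Y \<omega>))\<^sup>2)"
  proof (rule Bochner_Integration.integrable_bound)
    show "integrable P (\<lambda>\<omega>. \<delta>\<^sup>2 + 2 * \<delta> * \<sigma> * norm (\<epsilon> \<omega>) + \<sigma>\<^sup>2 * (norm (\<epsilon> \<omega>))\<^sup>2)"
      using integrable_norm_noise noise_square_integrable by simp
    show "AE \<omega> in P. norm ((norm (Y \<omega>))\<^sup>2)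
        \<le> norm (\<delta>\<^sup>2 + 2 * \<delta> * \<sigma> * norm (\<epsilon> \<omega>) + \<sigma>\<^sup>2 * (norm (\<epsilon> \<omega>))\<^sup>2)"
    proof (rule AE_I2)
      fix \<omega> assume "\<omega> \<in> space P"
      then have "norm (Y \<omega>) \<le> \<delta> + \<sigma> * norm (\<epsilon> \<omega>)"
        using close norm_triangle_sub[of "Y \<omega>" "\<sigma> *\<^sub>R \<epsilon> \<omega>"] \<open>0 \<le> \<sigma>\<close> by fastforce
      then have "(norm (Y \<omega>))\<^sup>2 \<le> (\<delta> + \<sigma> * norm (\<epsilon> \<omega>))\<^sup>2"
        by (rule power_mono) simp
      also have "\<dots> = \<delta>\<^sup>2 + 2 * \<delta> * \<sigma> * norm (\<epsilon> \<omega>) + \<sigma>\<^sup>2 * (norm (\<epsilon> \<omega>))\<^sup>2"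
        by (simp add: power2_eq_square algebra_simps)
      finally show "norm ((norm (Y \<omega>))\<^sup>2)
          \<le> norm (\<delta>\<^sup>2 + 2 * \<delta> * \<sigma> * norm (\<epsilon> \<omega>) + \<sigma>\<^sup>2 * (norm (\<epsilon> \<omega>))\<^sup>2)"
        by simp
    qed
  qed measurable
  note int_Y = integrable_orbit_support[OF Y Y_square]
  have hom: "L (r *\<^sub>R x) = r * L x" if "0 \<le> r" for r x
    using that by (simp add: L_def orbit_support_scaleR_left)
  have "(norm m)\<^sup>2 - 2 * L m + (\<integral>\<omega>. (norm (Y \<omega>))\<^sup>2 \<partial>P)
      \<le> (norm x)\<^sup>2 - 2 * L x + (\<integral>\<omega>. (norm (Y \<omega>))\<^sup>2 \<partial>P)" for x
    using mean by (simp add: represents_frechet_mean_def orbit_variance_eq[OF Y Y_square] L_def)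
  note radial = minimizer_radial[of L, OF hom this]
  have near: "\<bar>L w - \<sigma> * L\<epsilon> w\<bar> \<le> \<delta>" if w: "norm w = 1" for w
  proof -
    have "L w - \<sigma> * L\<epsilon> w
        = (\<integral>\<omega>. orbit_support G \<phi> w (Y \<omega>) - orbit_support G \<phi> w (\<sigma> *\<^sub>R \<epsilon> \<omega>) \<partial>P)"
      using \<open>0 \<le> \<sigma>\<close> int_Y integrable_noise_support
      by (simp add: L_def L\<epsilon>_def orbit_support_scaleR_right)
    also have "\<bar>\<dots>\<bar>
        \<le> (\<integral>\<omega>. \<bar>orbit_support G \<phi> w (Y \<omega>) - orbit_support G \<phi> w (\<sigma> *\<^sub>R \<epsilon> \<omega>)\<bar> \<partial>P)"
      by (rule integral_abs_bound)
    also have "\<dots> \<le> (\<integral>\<omega>. \<delta> \<partial>P)"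
    proof (rule integral_mono)
      show "integrable P (\<lambda>\<omega>. \<bar>orbit_support G \<phi> w (Y \<omega>) - orbit_support G \<phi> w (\<sigma> *\<^sub>R \<epsilon> \<omega>)\<bar>)"
        using \<open>0 \<le> \<sigma>\<close> int_Y integrable_noise_support by (simp add: orbit_support_scaleR_right)
      fix \<omega> assume "\<omega> \<in> space P"
      then show "\<bar>orbit_support G \<phi> w (Y \<omega>) - orbit_support G \<phi> w (\<sigma> *\<^sub>R \<epsilon> \<omega>)\<bar> \<le> \<delta>"
        using orbit_support_Lipschitz[of w "Y \<omega>" "\<sigma> *\<^sub>R \<epsilon> \<omega>"] close[of \<omega>] w by simp
    qed simp
    finally show ?thesis
      by (simp add: prob_space)
  qed
  have "\<sigma> * K \<le> norm m + \<delta>"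
  proof (cases "\<sigma> = 0")
    case True
    then show ?thesis using \<delta> by simp
  next
    case False
    with \<open>0 \<le> \<sigma>\<close> have \<sigma>: "\<sigma> > 0" by simp
    have "K \<le> (norm m + \<delta>) / \<sigma>"
      unfolding K_def bias_constant_eq
    proof (rule cSUP_least)
      show "{v :: 'm. norm v = 1} \<noteq> {}"
        using unit by blast
      fix w :: 'm assume "w \<in> {v. norm v = 1}"
      then have "\<sigma> * L\<epsilon> w \<le> norm m + \<delta>"
        using near[of w] radial(2)[of w] by fastforce
      then show "(\<integral>\<omega>. orbit_support G \<phi> w (\<epsilon> \<omega>) \<partial>P) \<le> (norm m + \<delta>) / \<sigma>"
        using \<sigma> by (simp add: L\<epsilon>_def field_simps)
    qed
    then show ?thesis
      using \<sigma> by (simp add: field_simps)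
  qed
  moreover have "norm m \<le> \<sigma> * K + \<delta>"
  proof (cases "m = 0")
    case True
    then show ?thesis
      using \<delta> \<open>0 \<le> \<sigma>\<close> K_nonneg by (simp add: K_def)
  next
    case False
    define w where "w = (1 / norm m) *\<^sub>R m"
    have w: "norm w = 1"
      using False by (simp add: w_def)
    have "norm m = L w"
      using hom[of "1 / norm m" m] radial(1) False by (simp add: w_def power2_eq_square)
    also have "\<dots> \<le> \<sigma> * L\<epsilon> w + \<delta>"
      using near[OF w] by simp
    also have "\<dots> \<le> \<sigma> * K + \<delta>"
      using expectation_noise_support_le_bias_constant[OF w] \<open>0 \<le> \<sigma>\<close>
      by (simp add: K_def L\<epsilon>_def mult_left_mono)
    finally show ?thesis .
  qed
  ultimately show ?thesis
    by (simp add: K_def abs_le_iff)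
qed

end

section \<open>The consistency bias\<close>

theorem theorem2p4:
  fixes G :: "('g, 'r) monoid_scheme"
    and \<phi> :: "'g \<Rightarrow> 'm::{real_inner, complete_space} \<Rightarrow> 'm"
    and P :: "'w measure"
    and \<G> :: "'g measure"
    and \<Phi> :: "'w \<Rightarrow> 'g"
    and \<epsilon> :: "'w \<Rightarrow> 'm"
    and t\<^sub>0 :: 'm
  assumes "isometric_action G \<phi>"
    and "prob_space P"
    and "space \<G> = carrier G"
    and "\<Phi> \<in> measurable P \<G>"
    and "standardized_noise P \<epsilon>"
    and "independent_rv P \<G> \<Phi> borel \<epsilon>"
    and "\<And>\<sigma>. \<sigma> > 0 \<Longrightarrow> observation \<phi> t\<^sub>0 \<Phi> \<epsilon> \<sigma> \<in> borel_measurable P"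
    and "\<not> law_support P \<epsilon> \<subseteq> fixed_points G \<phi>"
  defines "K \<equiv> bias_constant P G \<phi> \<epsilon>"
  shows "K \<in> {0<..1} \<and>
    (\<forall>\<sigma> m. \<sigma> > 0 \<longrightarrow> represents_frechet_mean P G \<phi> (observation \<phi> t\<^sub>0 \<Phi> \<epsilon> \<sigma>) m \<longrightarrow>
       \<sigma> * K - 2 * norm t\<^sub>0 \<le> quot_dist G \<phi> t\<^sub>0 m \<and>
       quot_dist G \<phi> t\<^sub>0 m \<le> \<sigma> * K + 2 * norm t\<^sub>0) \<and>
    (\<forall>m. (\<forall>\<^sub>F \<sigma> in at_top.
            represents_frechet_mean P G \<phi> (observation \<phi> t\<^sub>0 \<Phi> \<epsilon> \<sigma>) (m \<sigma>)) \<longrightarrow>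
       (\<lambda>\<sigma>. quot_dist G \<phi> t\<^sub>0 (m \<sigma>) - \<sigma> * K) \<in> o[at_top](\<lambda>\<sigma>. \<sigma>))"
proof -
  interpret noisy_isometric_group_action G \<phi> P \<epsilon>
    using assms(1,2,5)
    by (intro noisy_isometric_group_action.intro isometric_group_action.intro
        noisy_isometric_group_action_axioms.intro)
  have K: "0 < K" "K \<le> 1"
    using bias_constant_bounds[OF assms(8)] by (simp_all add: K_def)
  have unit: "\<exists>v :: 'm. norm v = 1"
  proof -
    obtain x g where g: "g \<in> carrier G" "\<phi> g x \<noteq> x"
      using assms(8) by (auto simp: fixed_points_def)
    then have "x \<noteq> 0"
      using linear_0[OF linear_act] by metis
    then show ?thesis
      by (intro exI[of _ "sgn x"]) (simp add: norm_sgn)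
  qed
  have bias: "\<bar>quot_dist G \<phi> t\<^sub>0 m - \<sigma> * K\<bar> \<le> 2 * norm t\<^sub>0"
    if \<sigma>: "\<sigma> > 0" and m: "represents_frechet_mean P G \<phi> (observation \<phi> t\<^sub>0 \<Phi> \<epsilon> \<sigma>) m" for \<sigma> m
  proof -
    have "\<bar>norm m - \<sigma> * K\<bar> \<le> norm t\<^sub>0"
      unfolding K_def
    proof (rule norm_frechet_mean[OF assms(7)[OF \<sigma>] _ _ _ unit m])
      fix \<omega> assume "\<omega> \<in> space P"
      then have "\<Phi> \<omega> \<in> carrier G"
        using assms(3,4) measurable_space by metis
      then show "norm (observation \<phi> t\<^sub>0 \<Phi> \<epsilon> \<sigma> \<omega> - \<sigma> *\<^sub>R \<epsilon> \<omega>) \<le> norm t\<^sub>0"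
        by (simp add: observation_def)
    qed (use \<sigma> K in \<open>simp_all add: K_def\<close>)
    then show ?thesis
      using quot_dist_norm_bound[of t\<^sub>0 m] by linarith
  qed
  have asymptotics: "(\<lambda>\<sigma>. quot_dist G \<phi> t\<^sub>0 (m \<sigma>) - \<sigma> * K) \<in> o[at_top](\<lambda>\<sigma>. \<sigma>)"
    if "\<forall>\<^sub>F \<sigma> in at_top. represents_frechet_mean P G \<phi> (observation \<phi> t\<^sub>0 \<Phi> \<epsilon> \<sigma>) (m \<sigma>)" for m
  proof -
    have "\<forall>\<^sub>F \<sigma> in at_top. norm (quot_dist G \<phi> t\<^sub>0 (m \<sigma>) - \<sigma> * K) \<le> 2 * norm t\<^sub>0 * norm (1::real)"
      using that eventually_gt_at_top[of 0] by eventually_elim (simp add: bias)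
    then have "(\<lambda>\<sigma>. quot_dist G \<phi> t\<^sub>0 (m \<sigma>) - \<sigma> * K) \<in> O[at_top](\<lambda>_. 1)"
      by (rule bigoI)
    moreover have "(\<lambda>_. 1) \<in> o[at_top](\<lambda>\<sigma>::real. \<sigma>)"
      by (intro smalloI_tendsto tendsto_divide_0[OF tendsto_const]
          filterlim_at_top_imp_at_infinity filterlim_ident)
        (use eventually_gt_at_top[of "0::real"] in \<open>auto elim: eventually_mono\<close>)
    ultimately show ?thesis
      by (rule landau_o.big_small_trans)
  qed
  have bounds: "\<sigma> * K - 2 * norm t\<^sub>0 \<le> quot_dist G \<phi> t\<^sub>0 m \<and> quot_dist G \<phi> t\<^sub>0 m \<le> \<sigma> * K + 2 * norm t\<^sub>0"
    if "\<sigma> > 0" "represents_frechet_mean P G \<phi> (observation \<phi> t\<^sub>0 \<Phi> \<epsilon> \<sigma>) m" for \<sigma> m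
    using bias[OF that] by linarith
  show ?thesis
    using K bounds asymptotics by auto
qed

end
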